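(* Let $X$ be a locally path-connected exterior space. (i) If $x,x'\in L(\check C_0(X))$ and $x\neq x'$, then there are open subsets $W,W'$ of $\check C_0(X)$ such that $x\in W$, $x'\in W'$ and $W\cap W'=\emptyset$. In particular, $\check\pi_0(X)\cong L(\check C_0(X))$ is a Hausdorff space. (ii) If $X$ is a Hausdorff space and for every $x\in X\setminus L(X)$ there is a closed neighbourhood $F$ of $x$ such that $X\setminus F$ is exterior (i.e. $X\setminus F\in\varepsilon(X)$), then $\check C_0(X)$ is a Hausdorff space. In this case $L(X)$ is a closed subset of $X$.
   Context: Exterior spaces: an exterior space is a topological space $X$ together with a nonempty family $\varepsilon(X)$ of open subsets (an externology; its members are called exterior open subsets) closed under finite intersections and such that if $E\in\varepsilon(X)$, $U$ is open and $E\subset U$, then $U\in\varepsilon(X)$. Limit and end spaces: for a space $Y$, $\pi_0(Y)$ is the set of path-components with the quotient topology of $q_0\colon Y\to\pi_0(Y)$. $L(X)=\bigcap_{E\in\varepsilon(X)}E$ (subspace topology); $\check\pi_0(X)=\lim_{E\in\varepsilon(X)}\pi_0(E)$ (inverse limit topology), with projections $\eta_{0,E}\colon\check\pi_0(X)\to\pi_0(E)$; $e_0\colon L(X)\to\check\pi_0(X)$ sends $x$ to the family of path-components of $x$ in the sets $E$. Completion: $\check C_0(X)$ has underlying set the push-out $X\cup_{L(X)}\check\pi_0(X)$ of the inclusion $L(X)\to X$ and $e_0$, with canonical maps $p_0\colon X\to\check C_0(X)$, $\operatorname{in}_0\colon\check\pi_0(X)\to\check C_0(X)$. A subset $W$ is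 open iff (i) $p_0^{-1}(W)$ and $\operatorname{in}_0^{-1}(W)$ are open, and (ii) for each $a\in\operatorname{in}_0^{-1}(W)$ there are $E\in\varepsilon(X)$ and an open $G\subset\pi_0(E)$ with $a\in\eta_{0,E}^{-1}(G)\subset\operatorname{in}_0^{-1}(W)$ and $q_0^{-1}(G)\subset p_0^{-1}(W)$. Its externology is $\{W_0(E): E\in\varepsilon(X)\}$ with $W_0(E)=p_0(E)\cup\operatorname{in}_0(\check\pi_0(X))$; $L(\check C_0(X))=\bigcap_E W_0(E)$, and the homeomorphism $\check\pi_0(X)\cong L(\check C_0(X))$ is the one given by $\operatorname{in}_0$, with $L(\check C_0(X))=\operatorname{in}_0(\check\pi_0(X))$. *)

theory Defs
  imports "HOL-Analysis.Analysis"
begin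

definition exterior_space :: "'a topology \<Rightarrow> 'a set set \<Rightarrow> bool" where
  "exterior_space X \<epsilon> \<longleftrightarrow>
     \<epsilon> \<noteq> {} \<and>
     (\<forall>E\<in>\<epsilon>. openin X E) \<and>
     (\<forall>E\<in>\<epsilon>. \<forall>E'\<in>\<epsilon>. E \<inter> E' \<in> \<epsilon>) \<and>
     (\<forall>E\<in>\<epsilon>. \<forall>U. openin X U \<and> E \<subseteq> U \<longrightarrow> U \<in> \<epsilon>)"

definition limit_set :: "'a set set \<Rightarrow> 'a set" where
  "limit_set \<epsilon> = \<Inter>\<epsilon>"

definition limit_space :: "'a topology \<Rightarrow> 'a set set \<Rightarrow> 'a topology" where
  "limit_space X \<epsilon> = subtopology X (limit_set \<epsilon>)"

definition quotient_topology :: "'a topology \<Rightarrow> ('a \<Rightarrow> 'b) \<Rightarrow> 'b topology" where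
  "quotient_topology Y q =
     topology (\<lambda>U. U \<subseteq> q ` topspace Y \<and> openin Y {y \<in> topspace Y. q y \<in> U})"

lemma openin_quotient_topology:
  "openin (quotient_topology Y q) U \<longleftrightarrow>
     U \<subseteq> q ` topspace Y \<and> openin Y {y \<in> topspace Y. q y \<in> U}"
proof -
  have "istopology (\<lambda>U. U \<subseteq> q ` topspace Y \<and> openin Y {y \<in> topspace Y. q y \<in> U})"
    unfolding istopology_def
  proof (intro conjI allI impI)
    fix S T
    assume S: "S \<subseteq> q ` topspace Y \<and> openin Y {y \<in> topspace Y. q y \<in> S}"
      and T: "T \<subseteq> q ` topspace Y \<and> openin Y {y \<in> topspace Y. q y \<in> T}"
    have "{y \<in> topspace Y. q y \<in> S \<inter> T}
        = {y \<in> topspace Y. q y \<in> S} \<inter> {y \<in> topspace Y. q y \<in> T}"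
      by blast
    then show "openin Y {y \<in> topspace Y. q y \<in> S \<inter> T}"
      using S T by (simp add: openin_Int)
    show "S \<inter> T \<subseteq> q ` topspace Y"
      using S by blast
  next
    fix \<K>
    assume K: "\<forall>K\<in>\<K>. K \<subseteq> q ` topspace Y \<and> openin Y {y \<in> topspace Y. q y \<in> K}"
    have "{y \<in> topspace Y. q y \<in> \<Union>\<K>} = \<Union>((\<lambda>K. {y \<in> topspace Y. q y \<in> K}) ` \<K>)"
      by blast
    moreover have "openin Y (\<Union>((\<lambda>K. {y \<in> topspace Y. q y \<in> K}) ` \<K>))"
      using K by (intro openin_Union) auto
    ultimately show "openin Y {y \<in> topspace Y. q y \<in> \<Union>\<K>}"
      by simp
    show "\<Union>\<K> \<subseteq> q ` topspace Y"
      using K by blast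
  qed
  then show ?thesis
    by (simp add: quotient_topology_def)
qed

lemma topspace_quotient_topology [simp]:
  "topspace (quotient_topology Y q) = q ` topspace Y"
proof
  show "topspace (quotient_topology Y q) \<subseteq> q ` topspace Y"
    using openin_topspace[of "quotient_topology Y q"] by (simp only: openin_quotient_topology)
  have "{y \<in> topspace Y. q y \<in> q ` topspace Y} = topspace Y"
    by blast
  then have "openin (quotient_topology Y q) (q ` topspace Y)"
    by (simp add: openin_quotient_topology)
  then show "q ` topspace Y \<subseteq> topspace (quotient_topology Y q)"
    by (rule openin_subset)
qed

abbreviation q0 :: "'a topology \<Rightarrow> 'a \<Rightarrow> 'a set" where
  "q0 Y x \<equiv> path_component_of_set Y x"

definition pi0 :: "'a topology \<Rightarrow> 'a set topology" where
  "pi0 Y = quotient_topology Y (q0 Y)"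

lemma topspace_pi0 [simp]: "topspace (pi0 Y) = path_components_of Y"
  by (simp add: pi0_def path_components_of_def)

text \<open>The map on path-components induced by the inclusion of a subspace into \<open>Y\<close>.\<close>

definition pi0_inclusion :: "'a topology \<Rightarrow> 'a set \<Rightarrow> 'a set" where
  "pi0_inclusion Y C = (THE D. D \<in> path_components_of Y \<and> C \<subseteq> D)"

lemma pi0_inclusion_q0:
  assumes "A \<subseteq> B" "x \<in> topspace X" "x \<in> A"
  shows "pi0_inclusion (subtopology X B) (q0 (subtopology X A) x) = q0 (subtopology X B) x"
  unfolding pi0_inclusion_def
proof (rule the_equality)
  show "q0 (subtopology X B) x \<in> path_components_of (subtopology X B) \<and>
        q0 (subtopology X A) x \<subseteq> q0 (subtopology X B) x"
    using assms by (simp add: path_component_in_path_components_of path_component_of_mono subset_iff)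
next
  fix D
  assume D: "D \<in> path_components_of (subtopology X B) \<and> q0 (subtopology X A) x \<subseteq> D"
  have "x \<in> q0 (subtopology X A) x"
    using assms by (simp add: path_component_of_refl)
  with D have "x \<in> D" by blast
  with D obtain y where "D = q0 (subtopology X B) y" "path_component_of (subtopology X B) y x"
    unfolding path_components_of_def by auto
  then show "D = q0 (subtopology X B) x"
    by (simp add: path_component_of_equiv)
qed

text \<open>The inverse limit over the externology, ordered by inclusion, as the set of compatible
  families; a family is a function on \<open>\<epsilon>\<close>, extended by \<open>undefined\<close>, and the projection
  \<open>eta0 E\<close> is evaluation at \<open>E\<close>.\<close>

definition limit_pi0_set :: "'a topology \<Rightarrow> 'a set set \<Rightarrow> ('a set \<Rightarrow> 'a set) set" where
  "limit_pi0_set X \<epsilon> =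
     {a \<in> (\<Pi>\<^sub>E E\<in>\<epsilon>. path_components_of (subtopology X E)).
        \<forall>E\<in>\<epsilon>. \<forall>E'\<in>\<epsilon>. E \<subseteq> E' \<longrightarrow> pi0_inclusion (subtopology X E') (a E) = a E'}"

lemma limit_pi0_setD:
  assumes "a \<in> limit_pi0_set X \<epsilon>"
  shows "E \<in> \<epsilon> \<Longrightarrow> a E \<in> path_components_of (subtopology X E)"
    and "E \<in> \<epsilon> \<Longrightarrow> E' \<in> \<epsilon> \<Longrightarrow> E \<subseteq> E' \<Longrightarrow> pi0_inclusion (subtopology X E') (a E) = a E'"
  using assms by (auto simp: limit_pi0_set_def)

definition limit_pi0 :: "'a topology \<Rightarrow> 'a set set \<Rightarrow> ('a set \<Rightarrow> 'a set) topology" where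
  "limit_pi0 X \<epsilon> =
     subtopology (product_topology (\<lambda>E. pi0 (subtopology X E)) \<epsilon>) (limit_pi0_set X \<epsilon>)"

abbreviation (input) eta0 :: "'a set \<Rightarrow> ('a set \<Rightarrow> 'a set) \<Rightarrow> 'a set" where
  "eta0 E a \<equiv> a E"

lemma topspace_limit_pi0 [simp]: "topspace (limit_pi0 X \<epsilon>) = limit_pi0_set X \<epsilon>"
  by (auto simp: limit_pi0_def limit_pi0_set_def)

definition e0 :: "'a topology \<Rightarrow> 'a set set \<Rightarrow> 'a \<Rightarrow> ('a set \<Rightarrow> 'a set)" where
  "e0 X \<epsilon> x = (\<lambda>E\<in>\<epsilon>. q0 (subtopology X E) x)"

text \<open>The push-out of \<open>f : C \<rightarrow> A\<close> and \<open>g : C \<rightarrow> B\<close>, as the quotient of the disjoint union of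
  \<open>A\<close> and \<open>B\<close> by the equivalence relation generated by \<open>f c \<sim> g c\<close>.\<close>

definition pushout_rel ::
  "'c set \<Rightarrow> 'a set \<Rightarrow> 'b set \<Rightarrow> ('c \<Rightarrow> 'a) \<Rightarrow> ('c \<Rightarrow> 'b) \<Rightarrow> ('a + 'b) rel" where
  "pushout_rel C A B f g =
     (let r = {(Inl (f c), Inr (g c)) | c. c \<in> C}
      in (r \<union> r\<inverse>)\<^sup>* \<inter> ((A <+> B) \<times> (A <+> B)))"

definition pushout ::
  "'c set \<Rightarrow> 'a set \<Rightarrow> 'b set \<Rightarrow> ('c \<Rightarrow> 'a) \<Rightarrow> ('c \<Rightarrow> 'b) \<Rightarrow> ('a + 'b) set set" where
  "pushout C A B f g = (A <+> B) // pushout_rel C A B f g"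

lemma equiv_pushout_rel: "equiv (A <+> B) (pushout_rel C A B f g)"
proof (rule equivI)
  show "pushout_rel C A B f g \<subseteq> (A <+> B) \<times> (A <+> B)"
    by (auto simp: pushout_rel_def Let_def)
  show "refl_on (A <+> B) (pushout_rel C A B f g)"
    by (auto simp: refl_on_def pushout_rel_def Let_def)
  show "sym (pushout_rel C A B f g)"
    unfolding pushout_rel_def Let_def
    by (intro sym_Int sym_rtrancl sym_Un_converse) (auto simp: sym_def)
  show "trans (pushout_rel C A B f g)"
    unfolding pushout_rel_def Let_def
    by (intro trans_Int trans_rtrancl) (auto simp: trans_def)
qed

type_synonym 'a completion_point = "('a + ('a set \<Rightarrow> 'a set)) set"

definition completion_rel ::
  "'a topology \<Rightarrow> 'a set set \<Rightarrow> ('a + ('a set \<Rightarrow> 'a set)) rel" where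
  "completion_rel X \<epsilon> =
     pushout_rel (limit_set \<epsilon>) (topspace X) (limit_pi0_set X \<epsilon>) (\<lambda>x. x) (e0 X \<epsilon>)"

definition completion_set :: "'a topology \<Rightarrow> 'a set set \<Rightarrow> 'a completion_point set" where
  "completion_set X \<epsilon> =
     pushout (limit_set \<epsilon>) (topspace X) (limit_pi0_set X \<epsilon>) (\<lambda>x. x) (e0 X \<epsilon>)"

definition p0 :: "'a topology \<Rightarrow> 'a set set \<Rightarrow> 'a \<Rightarrow> 'a completion_point" where
  "p0 X \<epsilon> x = completion_rel X \<epsilon> `` {Inl x}"

definition in0 :: "'a topology \<Rightarrow> 'a set set \<Rightarrow> ('a set \<Rightarrow> 'a set) \<Rightarrow> 'a completion_point" where
  "in0 X \<epsilon> a = completion_rel X \<epsilon> `` {Inr a}"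

definition p0_preimage :: "'a topology \<Rightarrow> 'a set set \<Rightarrow> 'a completion_point set \<Rightarrow> 'a set" where
  "p0_preimage X \<epsilon> W = {x \<in> topspace X. p0 X \<epsilon> x \<in> W}"

definition in0_preimage ::
  "'a topology \<Rightarrow> 'a set set \<Rightarrow> 'a completion_point set \<Rightarrow> ('a set \<Rightarrow> 'a set) set" where
  "in0_preimage X \<epsilon> W = {a \<in> topspace (limit_pi0 X \<epsilon>). in0 X \<epsilon> a \<in> W}"

definition completion_open ::
  "'a topology \<Rightarrow> 'a set set \<Rightarrow> 'a completion_point set \<Rightarrow> bool" where
  "completion_open X \<epsilon> W \<longleftrightarrow>
     W \<subseteq> completion_set X \<epsilon> \<and>
     openin X (p0_preimage X \<epsilon> W) \<and>
     openin (limit_pi0 X \<epsilon>) (in0_preimage X \<epsilon> W) \<and>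
     (\<forall>a \<in> in0_preimage X \<epsilon> W. \<exists>E\<in>\<epsilon>. \<exists>G. openin (pi0 (subtopology X E)) G \<and>
        a \<in> {b \<in> topspace (limit_pi0 X \<epsilon>). eta0 E b \<in> G} \<and>
        {b \<in> topspace (limit_pi0 X \<epsilon>). eta0 E b \<in> G} \<subseteq> in0_preimage X \<epsilon> W \<and>
        {x \<in> topspace (subtopology X E). q0 (subtopology X E) x \<in> G} \<subseteq> p0_preimage X \<epsilon> W)"

definition ext_completion :: "'a topology \<Rightarrow> 'a set set \<Rightarrow> 'a completion_point topology" where
  "ext_completion X \<epsilon> = topology (completion_open X \<epsilon>)"

definition W0 :: "'a topology \<Rightarrow> 'a set set \<Rightarrow> 'a set \<Rightarrow> 'a completion_point set" where
  "W0 X \<epsilon> E = p0 X \<epsilon> ` E \<union> in0 X \<epsilon> ` topspace (limit_pi0 X \<epsilon>)"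

definition completion_externology ::
  "'a topology \<Rightarrow> 'a set set \<Rightarrow> 'a completion_point set set" where
  "completion_externology X \<epsilon> = W0 X \<epsilon> ` \<epsilon>"

lemma openin_pi0_bond_preimage:
  assumes "A \<subseteq> B" and G: "openin (pi0 (subtopology X B)) G"
  shows "openin (pi0 (subtopology X A))
           {C \<in> path_components_of (subtopology X A). pi0_inclusion (subtopology X B) C \<in> G}"
proof -
  let ?H = "{C \<in> path_components_of (subtopology X A). pi0_inclusion (subtopology X B) C \<in> G}"
  have "{x \<in> topspace (subtopology X A). q0 (subtopology X A) x \<in> ?H}
      = topspace (subtopology X A) \<inter>
        {x \<in> topspace (subtopology X B). q0 (subtopology X B) x \<in> G}"
    using assms(1) by (auto simp: path_component_in_path_components_of pi0_inclusion_q0)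
  moreover have "openin (subtopology X B)
                   {x \<in> topspace (subtopology X B). q0 (subtopology X B) x \<in> G}"
    using G by (simp add: pi0_def openin_quotient_topology)
  ultimately have "openin (subtopology X A)
                     {x \<in> topspace (subtopology X A). q0 (subtopology X A) x \<in> ?H}"
    using assms(1) by (simp add: openin_subtopology) blast
  then show ?thesis
    by (simp add: pi0_def openin_quotient_topology path_components_of_def)
qed

lemma completion_openD:
  assumes "completion_open X \<epsilon> W"
  shows "\<forall>a \<in> in0_preimage X \<epsilon> W. \<exists>E\<in>\<epsilon>. \<exists>G. openin (pi0 (subtopology X E)) G \<and>
           a \<in> {b \<in> topspace (limit_pi0 X \<epsilon>). b E \<in> G} \<and>
           {b \<in> topspace (limit_pi0 X \<epsilon>). b E \<in> G} \<subseteq> in0_preimage X \<epsilon> W \<and>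
           {x \<in> topspace (subtopology X E). q0 (subtopology X E) x \<in> G} \<subseteq> p0_preimage X \<epsilon> W"
  using assms unfolding completion_open_def by (elim conjE)

lemma istopology_completion_open:
  assumes X: "exterior_space X \<epsilon>"
  shows "istopology (completion_open X \<epsilon>)"
  unfolding istopology_def
proof (intro conjI allI impI)
  fix S T
  assume S: "completion_open X \<epsilon> S" and T: "completion_open X \<epsilon> T"
  have p: "p0_preimage X \<epsilon> (S \<inter> T) = p0_preimage X \<epsilon> S \<inter> p0_preimage X \<epsilon> T"
    by (auto simp: p0_preimage_def)
  have i: "in0_preimage X \<epsilon> (S \<inter> T) = in0_preimage X \<epsilon> S \<inter> in0_preimage X \<epsilon> T"
    by (auto simp: in0_preimage_def)
  show "completion_open X \<epsilon> (S \<inter> T)"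
    unfolding completion_open_def
  proof (intro conjI ballI)
    show "S \<inter> T \<subseteq> completion_set X \<epsilon>"
      using S by (auto simp: completion_open_def)
    show "openin X (p0_preimage X \<epsilon> (S \<inter> T))"
      using S T by (simp add: completion_open_def p openin_Int)
    show "openin (limit_pi0 X \<epsilon>) (in0_preimage X \<epsilon> (S \<inter> T))"
      using S T by (simp add: completion_open_def i openin_Int)
  next
    fix a
    assume a: "a \<in> in0_preimage X \<epsilon> (S \<inter> T)"
    then have aS: "a \<in> in0_preimage X \<epsilon> S" and aT: "a \<in> in0_preimage X \<epsilon> T"
      by (simp_all add: i)
    from bspec[OF completion_openD[OF S] aS] obtain E G where EG: "E \<in> \<epsilon>" "openin (pi0 (subtopology X E)) G"
      "a \<in> {b \<in> topspace (limit_pi0 X \<epsilon>). b E \<in> G}"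
      "{b \<in> topspace (limit_pi0 X \<epsilon>). b E \<in> G} \<subseteq> in0_preimage X \<epsilon> S"
      "{x \<in> topspace (subtopology X E). q0 (subtopology X E) x \<in> G} \<subseteq> p0_preimage X \<epsilon> S"
      by (elim bexE exE conjE) (rule that)
    from bspec[OF completion_openD[OF T] aT] obtain E' G' where EG': "E' \<in> \<epsilon>" "openin (pi0 (subtopology X E')) G'"
      "a \<in> {b \<in> topspace (limit_pi0 X \<epsilon>). b E' \<in> G'}"
      "{b \<in> topspace (limit_pi0 X \<epsilon>). b E' \<in> G'} \<subseteq> in0_preimage X \<epsilon> T"
      "{x \<in> topspace (subtopology X E'). q0 (subtopology X E') x \<in> G'} \<subseteq> p0_preimage X \<epsilon> T"
      by (elim bexE exE conjE) (rule that)
    define D where "D = E \<inter> E'"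
    have "\<forall>E\<in>\<epsilon>. \<forall>E'\<in>\<epsilon>. E \<inter> E' \<in> \<epsilon>"
      using X unfolding exterior_space_def by (elim conjE)
    then have D: "D \<in> \<epsilon>" "D \<subseteq> E" "D \<subseteq> E'"
      using EG(1) EG'(1) by (simp_all add: D_def)
    define H where "H = {C \<in> path_components_of (subtopology X D).
        pi0_inclusion (subtopology X E) C \<in> G} \<inter>
      {C \<in> path_components_of (subtopology X D). pi0_inclusion (subtopology X E') C \<in> G'}"
    have H: "openin (pi0 (subtopology X D)) H"
      unfolding H_def using D EG(2) EG'(2) by (intro openin_Int openin_pi0_bond_preimage)
    have eq: "b D \<in> H \<longleftrightarrow> b E \<in> G \<and> b E' \<in> G'" if b: "b \<in> limit_pi0_set X \<epsilon>" for b
    proof -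
      have "b D \<in> path_components_of (subtopology X D)"
        "pi0_inclusion (subtopology X E) (b D) = b E"
        "pi0_inclusion (subtopology X E') (b D) = b E'"
        using limit_pi0_setD[OF b] D EG(1) EG'(1) by blast+
      then show ?thesis
        by (simp add: H_def)
    qed
    have qH: "{x \<in> topspace (subtopology X D). q0 (subtopology X D) x \<in> H}
        \<subseteq> {x \<in> topspace (subtopology X E). q0 (subtopology X E) x \<in> G} \<inter>
          {x \<in> topspace (subtopology X E'). q0 (subtopology X E') x \<in> G'}"
    proof
      fix x
      assume x: "x \<in> {x \<in> topspace (subtopology X D). q0 (subtopology X D) x \<in> H}"
      then have xD: "x \<in> topspace X" "x \<in> D"
        by simp_all
      have "pi0_inclusion (subtopology X E) (q0 (subtopology X D) x) \<in> G"
        "pi0_inclusion (subtopology X E') (q0 (subtopology X D) x) \<in> G'"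
        using x by (simp_all only: H_def Int_iff mem_Collect_eq)
      then have "q0 (subtopology X E) x \<in> G" "q0 (subtopology X E') x \<in> G'"
        by (simp_all only: pi0_inclusion_q0[OF D(2) xD] pi0_inclusion_q0[OF D(3) xD])
      then show "x \<in> {x \<in> topspace (subtopology X E). q0 (subtopology X E) x \<in> G} \<inter>
          {x \<in> topspace (subtopology X E'). q0 (subtopology X E') x \<in> G'}"
        using xD D by auto
    qed
    show "\<exists>E\<in>\<epsilon>. \<exists>G. openin (pi0 (subtopology X E)) G \<and>
        a \<in> {b \<in> topspace (limit_pi0 X \<epsilon>). b E \<in> G} \<and>
        {b \<in> topspace (limit_pi0 X \<epsilon>). b E \<in> G} \<subseteq> in0_preimage X \<epsilon> (S \<inter> T) \<and>
        {x \<in> topspace (subtopology X E). q0 (subtopology X E) x \<in> G}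
          \<subseteq> p0_preimage X \<epsilon> (S \<inter> T)"
    proof (intro bexI[of _ D] exI[of _ H] conjI)
      have a': "a \<in> limit_pi0_set X \<epsilon>" "a E \<in> G" "a E' \<in> G'"
        using EG(3) EG'(3) by simp_all
      then have "a D \<in> H"
        using eq[OF a'(1)] by blast
      with a' show "a \<in> {b \<in> topspace (limit_pi0 X \<epsilon>). b D \<in> H}"
        by simp
      show "{b \<in> topspace (limit_pi0 X \<epsilon>). b D \<in> H} \<subseteq> in0_preimage X \<epsilon> (S \<inter> T)"
      proof
        fix b
        assume "b \<in> {b \<in> topspace (limit_pi0 X \<epsilon>). b D \<in> H}"
        then have b: "b \<in> limit_pi0_set X \<epsilon>" "b D \<in> H"
          by simp_all
        then have "b E \<in> G" "b E' \<in> G'"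
          using eq[OF b(1)] by blast+
        with b(1) show "b \<in> in0_preimage X \<epsilon> (S \<inter> T)"
          using subsetD[OF EG(4), of b] subsetD[OF EG'(4), of b] unfolding i by simp
      qed
      show "{x \<in> topspace (subtopology X D). q0 (subtopology X D) x \<in> H}
          \<subseteq> p0_preimage X \<epsilon> (S \<inter> T)"
        using qH EG(5) EG'(5) unfolding p by blast
    qed (rule H, rule D(1))
  qed
next
  fix \<K>
  assume K: "\<forall>K\<in>\<K>. completion_open X \<epsilon> K"
  have p: "p0_preimage X \<epsilon> (\<Union>\<K>) = \<Union>(p0_preimage X \<epsilon> ` \<K>)"
    by (auto simp: p0_preimage_def)
  have i: "in0_preimage X \<epsilon> (\<Union>\<K>) = \<Union>(in0_preimage X \<epsilon> ` \<K>)"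
    by (auto simp: in0_preimage_def)
  show "completion_open X \<epsilon> (\<Union>\<K>)"
    unfolding completion_open_def
  proof (intro conjI ballI)
    show "\<Union>\<K> \<subseteq> completion_set X \<epsilon>"
      using K by (auto simp: completion_open_def)
    show "openin X (p0_preimage X \<epsilon> (\<Union>\<K>))"
      using K unfolding p by (intro openin_Union) (auto simp: completion_open_def)
    show "openin (limit_pi0 X \<epsilon>) (in0_preimage X \<epsilon> (\<Union>\<K>))"
      using K unfolding i by (intro openin_Union) (auto simp: completion_open_def)
  next
    fix a
    assume "a \<in> in0_preimage X \<epsilon> (\<Union>\<K>)"
    then obtain K' where K': "K' \<in> \<K>" "a \<in> in0_preimage X \<epsilon> K'"
      by (auto simp: i)
    from bspec[OF completion_openD[OF bspec[OF K K'(1)]] K'(2)]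
    obtain E G where EG: "E \<in> \<epsilon>" "openin (pi0 (subtopology X E)) G"
      "a \<in> {b \<in> topspace (limit_pi0 X \<epsilon>). b E \<in> G}"
      "{b \<in> topspace (limit_pi0 X \<epsilon>). b E \<in> G} \<subseteq> in0_preimage X \<epsilon> K'"
      "{x \<in> topspace (subtopology X E). q0 (subtopology X E) x \<in> G} \<subseteq> p0_preimage X \<epsilon> K'"
      by (elim bexE exE conjE) (rule that)
    have sub: "in0_preimage X \<epsilon> K' \<subseteq> in0_preimage X \<epsilon> (\<Union>\<K>)"
      "p0_preimage X \<epsilon> K' \<subseteq> p0_preimage X \<epsilon> (\<Union>\<K>)"
      using K'(1) by (auto simp: p i)
    show "\<exists>E\<in>\<epsilon>. \<exists>G. openin (pi0 (subtopology X E)) G \<and>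
        a \<in> {b \<in> topspace (limit_pi0 X \<epsilon>). b E \<in> G} \<and>
        {b \<in> topspace (limit_pi0 X \<epsilon>). b E \<in> G} \<subseteq> in0_preimage X \<epsilon> (\<Union>\<K>) \<and>
        {x \<in> topspace (subtopology X E). q0 (subtopology X E) x \<in> G}
          \<subseteq> p0_preimage X \<epsilon> (\<Union>\<K>)"
      by (intro bexI[of _ E] exI[of _ G] conjI EG(1-3) subset_trans[OF EG(4) sub(1)]
          subset_trans[OF EG(5) sub(2)])
  qed
qed

lemma openin_completion:
  assumes "exterior_space X \<epsilon>"
  shows "openin (ext_completion X \<epsilon>) W \<longleftrightarrow> completion_open X \<epsilon> W"
  by (simp add: ext_completion_def istopology_completion_open[OF assms])

lemma topspace_completion:
  assumes X: "exterior_space X \<epsilon>"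
  shows "topspace (ext_completion X \<epsilon>) = completion_set X \<epsilon>"
proof
  show "topspace (ext_completion X \<epsilon>) \<subseteq> completion_set X \<epsilon>"
    using openin_topspace[of "ext_completion X \<epsilon>"]
    by (simp only: openin_completion[OF X] completion_open_def)
  have p: "p0_preimage X \<epsilon> (completion_set X \<epsilon>) = topspace X"
    by (auto simp: p0_preimage_def p0_def completion_set_def pushout_def completion_rel_def
        intro: quotientI)
  have i: "in0_preimage X \<epsilon> (completion_set X \<epsilon>) = topspace (limit_pi0 X \<epsilon>)"
    by (auto simp: in0_preimage_def in0_def completion_set_def pushout_def completion_rel_def
        intro: quotientI)
  obtain E where E: "E \<in> \<epsilon>"
    using X by (auto simp: exterior_space_def)
  have "completion_open X \<epsilon> (completion_set X \<epsilon>)"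
    unfolding completion_open_def p i
  proof (intro conjI ballI bexI[of _ E] exI[of _ "path_components_of (subtopology X E)"])
    show "openin (pi0 (subtopology X E)) (path_components_of (subtopology X E))"
      by (metis openin_topspace topspace_pi0)
    show "openin (limit_pi0 X \<epsilon>) (topspace (limit_pi0 X \<epsilon>))"
      by (rule openin_topspace)
  qed (use E in \<open>auto simp: limit_pi0_set_def PiE_iff\<close>)
  then show "completion_set X \<epsilon> \<subseteq> topspace (ext_completion X \<epsilon>)"
    by (simp add: openin_completion[OF X] openin_subset)
qed

end

theory Submission
  imports Defs
begin

text \<open>
  Why the theorem holds. The inclusion \<open>L(X) \<rightarrow> X\<close> is injective, so the push-out has a simple normal
  form: a point of the completion is either a point of \<open>X\<close> outside \<open>L(X)\<close> or an end, and a point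
  \<open>x\<close> of \<open>L(X)\<close> is glued to the end \<open>e\<^sub>0(x)\<close> (lemma \<open>pushout_rel_inclusion_iff\<close>). A subset of the
  completion is therefore the same thing as a pair \<open>(S, T)\<close> of a subset of \<open>X\<close> and a set of ends such
  that \<open>x \<in> S\<close> exactly when \<open>e\<^sub>0(x) \<in> T\<close> for all \<open>x \<in> L(X)\<close>, and such sets are disjoint as soon as
  both components are.

  Two kinds of open sets do all the separating. For \<open>E\<close> exterior and \<open>G\<close> open in \<open>\<pi>\<^sub>0(E)\<close>, the
  cylinder over \<open>G\<close>, which consists of the points of \<open>E\<close> whose component lies in \<open>G\<close> and the ends
  whose \<open>E\<close>-coordinate lies in \<open>G\<close>, is open (\<open>openin_cylinder\<close>): it satisfies the third openness
  condition at each of its ends with the pair \<open>(E, G)\<close> itself. An open subset of \<open>X\<close> that misses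
  \<open>L(X)\<close> is open in the completion as well (\<open>openin_glue_empty\<close>).

  Cylinders alone give the first part. They are the preimages under the coordinates of the inverse of
  \<open>in\<^sub>0\<close>, so this inverse is continuous. If \<open>X\<close> is locally path-connected, the path-components of an
  open set \<open>E\<close> are open, so \<open>\<pi>\<^sub>0(E)\<close> is discrete; two different ends differ in some coordinate \<open>E\<close>,
  and the cylinders over the two different components are disjoint.

  In the second part, a closed neighbourhood \<open>F\<close> of \<open>x\<close> with exterior complement separates \<open>x\<close> from
  all ends at once: the cylinder of all components of \<open>X - F\<close> contains every end and misses a
  neighbourhood of \<open>x\<close>. This neighbourhood also misses \<open>L(X)\<close>, so \<open>L(X)\<close> is closed, and two points
  outside \<open>L(X)\<close> are separated inside the open set \<open>X - L(X)\<close>.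
\<close>

section \<open>Points of the completion\<close>

text \<open>
  Replacing each \<open>x \<in> C\<close> by its partner \<open>g x\<close> is a normal form for the push-out of an inclusion:
  it is invariant under the generating relation, and each point is related to its normal form.
\<close>

lemma pushout_rel_inclusion_iff:
  fixes g :: "'a \<Rightarrow> 'b" and C :: "'a set"
  defines "nf \<equiv> case_sum (\<lambda>x. if x \<in> C then Inr (g x) else Inl x) Inr"
  shows "(u, v) \<in> pushout_rel C A B (\<lambda>x. x) g \<longleftrightarrow> u \<in> A <+> B \<and> v \<in> A <+> B \<and> nf u = nf v"
proof -
  define r where "r = {(Inl c :: 'a + 'b, Inr (g c) :: 'a + 'b) | c. c \<in> C}"
  have "nf s = nf t" if "(s, t) \<in> (r \<union> r\<inverse>)\<^sup>*" for s t
    using that by (induction rule: rtrancl_induct) (auto simp: r_def nf_def)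
  moreover have "(s, nf s) \<in> (r \<union> r\<inverse>)\<^sup>*" for s
    by (cases s) (auto simp: r_def nf_def)
  moreover have "sym ((r \<union> r\<inverse>)\<^sup>*)"
    by (intro sym_rtrancl sym_Un_converse)
  ultimately have "(u, v) \<in> (r \<union> r\<inverse>)\<^sup>* \<longleftrightarrow> nf u = nf v"
    by (metis rtrancl_trans symD)
  then show ?thesis
    by (auto simp: pushout_rel_def Let_def r_def)
qed

lemma p0_eq_p0_iff:
  assumes "x \<in> topspace X" "y \<in> topspace X"
  shows "p0 X \<epsilon> x = p0 X \<epsilon> y \<longleftrightarrow>
    x = y \<or> x \<in> limit_set \<epsilon> \<and> y \<in> limit_set \<epsilon> \<and> e0 X \<epsilon> x = e0 X \<epsilon> y"
  unfolding p0_def completion_rel_def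
  by (subst eq_equiv_class_iff[OF equiv_pushout_rel])
    (use assms in \<open>auto simp: pushout_rel_inclusion_iff\<close>)

lemma in0_eq_in0_iff:
  assumes "a \<in> limit_pi0_set X \<epsilon>" "b \<in> limit_pi0_set X \<epsilon>"
  shows "in0 X \<epsilon> a = in0 X \<epsilon> b \<longleftrightarrow> a = b"
  unfolding in0_def completion_rel_def
  by (subst eq_equiv_class_iff[OF equiv_pushout_rel])
    (use assms in \<open>auto simp: pushout_rel_inclusion_iff\<close>)

lemma p0_eq_in0_iff:
  assumes "x \<in> topspace X" "a \<in> limit_pi0_set X \<epsilon>"
  shows "p0 X \<epsilon> x = in0 X \<epsilon> a \<longleftrightarrow> x \<in> limit_set \<epsilon> \<and> e0 X \<epsilon> x = a"
  unfolding p0_def in0_def completion_rel_def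
  by (subst eq_equiv_class_iff[OF equiv_pushout_rel])
    (use assms in \<open>auto simp: pushout_rel_inclusion_iff\<close>)

lemma completion_set_eq:
  "completion_set X \<epsilon> = p0 X \<epsilon> ` topspace X \<union> in0 X \<epsilon> ` limit_pi0_set X \<epsilon>"
  unfolding completion_set_def pushout_def p0_def in0_def completion_rel_def quotient_def by auto

lemma exterior_openin: "exterior_space X \<epsilon> \<Longrightarrow> E \<in> \<epsilon> \<Longrightarrow> openin X E"
  by (simp add: exterior_space_def)

lemma exterior_subset_topspace: "exterior_space X \<epsilon> \<Longrightarrow> E \<in> \<epsilon> \<Longrightarrow> E \<subseteq> topspace X"
  by (simp add: exterior_openin openin_subset)

lemma limit_set_subset: "E \<in> \<epsilon> \<Longrightarrow> limit_set \<epsilon> \<subseteq> E"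
  by (auto simp: limit_set_def)

lemma limit_set_subset_topspace: "exterior_space X \<epsilon> \<Longrightarrow> limit_set \<epsilon> \<subseteq> topspace X"
  by (metis exterior_space_def exterior_subset_topspace limit_set_subset equals0I subset_trans)

lemma e0_in_limit_pi0_set:
  assumes "exterior_space X \<epsilon>" "x \<in> limit_set \<epsilon>"
  shows "e0 X \<epsilon> x \<in> limit_pi0_set X \<epsilon>"
proof -
  have x: "x \<in> topspace X" "\<And>E. E \<in> \<epsilon> \<Longrightarrow> x \<in> E"
    using assms limit_set_subset_topspace[OF assms(1)] by (auto simp: limit_set_def)
  then show ?thesis
    by (auto simp: limit_pi0_set_def e0_def path_component_in_path_components_of pi0_inclusion_q0)
qed

text \<open>
  A point of every \<open>W\<^sub>0(E)\<close> that is not an end has a single representative in \<open>X\<close>; that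
  representative would then lie in every \<open>E\<close>, hence in \<open>L(X)\<close>, and be glued to an end after all.
\<close>

lemma limit_set_completion:
  assumes X: "exterior_space X \<epsilon>"
  shows "limit_set (completion_externology X \<epsilon>) = in0 X \<epsilon> ` limit_pi0_set X \<epsilon>"
proof
  show "in0 X \<epsilon> ` limit_pi0_set X \<epsilon> \<subseteq> limit_set (completion_externology X \<epsilon>)"
    by (auto simp: limit_set_def completion_externology_def W0_def)
  show "limit_set (completion_externology X \<epsilon>) \<subseteq> in0 X \<epsilon> ` limit_pi0_set X \<epsilon>"
  proof
    fix z assume z: "z \<in> limit_set (completion_externology X \<epsilon>)"
    show "z \<in> in0 X \<epsilon> ` limit_pi0_set X \<epsilon>"
    proof (rule ccontr)
      assume nz: "z \<notin> in0 X \<epsilon> ` limit_pi0_set X \<epsilon>"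
      have zE: "z \<in> p0 X \<epsilon> ` E" if "E \<in> \<epsilon>" for E
        using z nz that by (auto simp: limit_set_def completion_externology_def W0_def)
      obtain E where "E \<in> \<epsilon>"
        using X by (auto simp: exterior_space_def)
      with zE obtain x where x: "x \<in> topspace X" "z = p0 X \<epsilon> x"
        using exterior_subset_topspace[OF X] by blast
      have not_limit: "x \<notin> limit_set \<epsilon>"
        using nz x p0_eq_in0_iff[OF x(1)] e0_in_limit_pi0_set[OF X] by blast
      have "x \<in> E'" if E': "E' \<in> \<epsilon>" for E'
      proof -
        obtain y where "y \<in> E'" "p0 X \<epsilon> x = p0 X \<epsilon> y"
          using zE[OF E'] x by auto
        then show ?thesis
          using p0_eq_p0_iff[OF x(1), of y] not_limit exterior_subset_topspace[OF X E'] by blast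
      qed
      with not_limit show False
        by (simp add: limit_set_def)
    qed
  qed
qed

section \<open>Open sets of the completion\<close>

definition glue ::
  "'a topology \<Rightarrow> 'a set set \<Rightarrow> 'a set \<Rightarrow> ('a set \<Rightarrow> 'a set) set \<Rightarrow> 'a completion_point set" where
  "glue X \<epsilon> S T = p0 X \<epsilon> ` S \<union> in0 X \<epsilon> ` T"

text \<open>The condition under which \<open>(S, T)\<close> is recovered from the union of the two images.\<close>

definition compatible ::
  "'a topology \<Rightarrow> 'a set set \<Rightarrow> 'a set \<Rightarrow> ('a set \<Rightarrow> 'a set) set \<Rightarrow> bool" where
  "compatible X \<epsilon> S T \<longleftrightarrow> S \<subseteq> topspace X \<and> T \<subseteq> limit_pi0_set X \<epsilon> \<and>
     (\<forall>x\<in>limit_set \<epsilon>. x \<in> S \<longleftrightarrow> e0 X \<epsilon> x \<in> T)"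

lemma p0_preimage_glue:
  assumes "compatible X \<epsilon> S T"
  shows "p0_preimage X \<epsilon> (glue X \<epsilon> S T) = S"
proof -
  have "x \<in> S" if x: "x \<in> topspace X" and z: "p0 X \<epsilon> x \<in> glue X \<epsilon> S T" for x
  proof -
    consider y where "y \<in> S" "p0 X \<epsilon> x = p0 X \<epsilon> y" | a where "a \<in> T" "p0 X \<epsilon> x = in0 X \<epsilon> a"
      using z by (auto simp: glue_def)
    then show ?thesis
    proof cases
      case (1 y)
      then have "y \<in> topspace X"
        using assms by (auto simp: compatible_def)
      with 1 p0_eq_p0_iff[OF x this] show ?thesis
        using assms by (auto simp: compatible_def)
    next
      case (2 a)
      then have "a \<in> limit_pi0_set X \<epsilon>"
        using assms by (auto simp: compatible_def)
      with 2 p0_eq_in0_iff[OF x this] show ?thesis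
        using assms by (auto simp: compatible_def)
    qed
  qed
  then show ?thesis
    using assms by (auto simp: p0_preimage_def glue_def compatible_def)
qed

lemma in0_preimage_glue:
  assumes "compatible X \<epsilon> S T"
  shows "in0_preimage X \<epsilon> (glue X \<epsilon> S T) = T"
proof -
  have "a \<in> T" if a: "a \<in> limit_pi0_set X \<epsilon>" and z: "in0 X \<epsilon> a \<in> glue X \<epsilon> S T" for a
  proof -
    consider x where "x \<in> S" "p0 X \<epsilon> x = in0 X \<epsilon> a" | b where "b \<in> T" "in0 X \<epsilon> a = in0 X \<epsilon> b"
      using z by (fastforce simp: glue_def)
    then show ?thesis
    proof cases
      case (1 x)
      then have "x \<in> topspace X"
        using assms by (auto simp: compatible_def)
      with 1 p0_eq_in0_iff[OF this a] show ?thesis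
        using assms by (auto simp: compatible_def)
    next
      case (2 b)
      then have "b \<in> limit_pi0_set X \<epsilon>"
        using assms by (auto simp: compatible_def)
      with 2 in0_eq_in0_iff[OF a this] show ?thesis
        by simp
    qed
  qed
  then show ?thesis
    using assms by (auto simp: in0_preimage_def glue_def compatible_def)
qed

lemma disjoint_glue:
  assumes "compatible X \<epsilon> S T" "compatible X \<epsilon> S' T'" "S \<inter> S' = {}" "T \<inter> T' = {}"
  shows "glue X \<epsilon> S T \<inter> glue X \<epsilon> S' T' = {}"
proof -
  have "z \<notin> glue X \<epsilon> S' T'" if z: "z \<in> glue X \<epsilon> S T" for z
  proof -
    consider x where "x \<in> S" "z = p0 X \<epsilon> x" | a where "a \<in> T" "z = in0 X \<epsilon> a"
      using z by (auto simp: glue_def)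
    then show ?thesis
    proof cases
      case (1 x)
      then have "x \<notin> p0_preimage X \<epsilon> (glue X \<epsilon> S' T')"
        using assms p0_preimage_glue by blast
      with 1 show ?thesis
        using assms(1) by (auto simp: p0_preimage_def compatible_def)
    next
      case (2 a)
      then have "a \<notin> in0_preimage X \<epsilon> (glue X \<epsilon> S' T')"
        using assms in0_preimage_glue by blast
      with 2 show ?thesis
        using assms(1) by (auto simp: in0_preimage_def compatible_def)
    qed
  qed
  then show ?thesis
    by blast
qed

lemma openin_glue:
  assumes "exterior_space X \<epsilon>" "compatible X \<epsilon> S T"
    and "openin X S" "openin (limit_pi0 X \<epsilon>) T"
    and "\<And>a. a \<in> T \<Longrightarrow> \<exists>E\<in>\<epsilon>. \<exists>G. openin (pi0 (subtopology X E)) G \<and>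
           a \<in> {b \<in> limit_pi0_set X \<epsilon>. b E \<in> G} \<and> {b \<in> limit_pi0_set X \<epsilon>. b E \<in> G} \<subseteq> T \<and>
           {x \<in> topspace (subtopology X E). q0 (subtopology X E) x \<in> G} \<subseteq> S"
  shows "openin (ext_completion X \<epsilon>) (glue X \<epsilon> S T)"
  unfolding openin_completion[OF assms(1)] completion_open_def
    p0_preimage_glue[OF assms(2)] in0_preimage_glue[OF assms(2)] topspace_limit_pi0
proof (intro conjI ballI)
  show "glue X \<epsilon> S T \<subseteq> completion_set X \<epsilon>"
    using assms(2) by (auto simp: glue_def completion_set_eq compatible_def)
qed (use assms in auto)

lemma compatible_empty_iff:
  "compatible X \<epsilon> U {} \<longleftrightarrow> U \<subseteq> topspace X \<and> U \<inter> limit_set \<epsilon> = {}"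
  by (auto simp: compatible_def)

text \<open>Such a set contains no ends, so the condition at the ends is vacuous.\<close>

lemma openin_glue_empty:
  assumes "exterior_space X \<epsilon>" "openin X U" "U \<inter> limit_set \<epsilon> = {}"
  shows "openin (ext_completion X \<epsilon>) (glue X \<epsilon> U {})"
  using assms by (intro openin_glue) (auto simp: compatible_empty_iff openin_subset)

definition points_over :: "'a topology \<Rightarrow> 'a set \<Rightarrow> 'a set set \<Rightarrow> 'a set" where
  "points_over X E G = {x \<in> topspace (subtopology X E). q0 (subtopology X E) x \<in> G}"

definition ends_over ::
  "'a topology \<Rightarrow> 'a set set \<Rightarrow> 'a set \<Rightarrow> 'a set set \<Rightarrow> ('a set \<Rightarrow> 'a set) set" where
  "ends_over X \<epsilon> E G = {b \<in> limit_pi0_set X \<epsilon>. b E \<in> G}"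

abbreviation cylinder ::
  "'a topology \<Rightarrow> 'a set set \<Rightarrow> 'a set \<Rightarrow> 'a set set \<Rightarrow> 'a completion_point set" where
  "cylinder X \<epsilon> E G \<equiv> glue X \<epsilon> (points_over X E G) (ends_over X \<epsilon> E G)"

lemma compatible_cylinder:
  assumes "exterior_space X \<epsilon>" "E \<in> \<epsilon>"
  shows "compatible X \<epsilon> (points_over X E G) (ends_over X \<epsilon> E G)"
  using assms limit_set_subset[OF assms(2)] limit_set_subset_topspace[OF assms(1)]
    e0_in_limit_pi0_set[OF assms(1)]
  by (auto simp: compatible_def points_over_def ends_over_def e0_def)

lemma in0_in_cylinder_iff:
  assumes "exterior_space X \<epsilon>" "E \<in> \<epsilon>" "a \<in> limit_pi0_set X \<epsilon>"
  shows "in0 X \<epsilon> a \<in> cylinder X \<epsilon> E G \<longleftrightarrow> a E \<in> G"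
  using in0_preimage_glue[OF compatible_cylinder[OF assms(1,2), of G]] assms(3)
  by (auto simp: in0_preimage_def ends_over_def set_eq_iff)

lemma continuous_map_eta0:
  assumes "E \<in> \<epsilon>"
  shows "continuous_map (limit_pi0 X \<epsilon>) (pi0 (subtopology X E)) (\<lambda>a. a E)"
  unfolding limit_pi0_def
  by (intro continuous_map_from_subtopology continuous_map_product_projection assms)

lemma openin_cylinder:
  assumes X: "exterior_space X \<epsilon>" and E: "E \<in> \<epsilon>" and G: "openin (pi0 (subtopology X E)) G"
  shows "openin (ext_completion X \<epsilon>) (cylinder X \<epsilon> E G)"
proof (rule openin_glue[OF X compatible_cylinder[OF X E]])
  have "openin (subtopology X E) (points_over X E G)"
    using G by (simp add: pi0_def openin_quotient_topology points_over_def)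
  then show "openin X (points_over X E G)"
    using exterior_openin[OF X E] openin_trans_full by blast
  show "openin (limit_pi0 X \<epsilon>) (ends_over X \<epsilon> E G)"
    using openin_continuous_map_preimage[OF continuous_map_eta0[OF E] G]
    by (simp add: ends_over_def)
next
  fix a assume "a \<in> ends_over X \<epsilon> E G"
  then show "\<exists>E'\<in>\<epsilon>. \<exists>G'. openin (pi0 (subtopology X E')) G' \<and>
      a \<in> {b \<in> limit_pi0_set X \<epsilon>. b E' \<in> G'} \<and>
      {b \<in> limit_pi0_set X \<epsilon>. b E' \<in> G'} \<subseteq> ends_over X \<epsilon> E G \<and>
      {x \<in> topspace (subtopology X E'). q0 (subtopology X E') x \<in> G'} \<subseteq> points_over X E G"
    using E G unfolding ends_over_def points_over_def by blast
qed

section \<open>The space of ends\<close>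

text \<open>
  Each coordinate of the inverse of \<open>in\<^sub>0\<close> is continuous, because the preimage of \<open>G\<close> is the trace of
  an open cylinder; the universal property of the inverse limit does the rest.
\<close>

lemma homeomorphic_map_in0:
  assumes X: "exterior_space X \<epsilon>"
  shows "homeomorphic_map (limit_pi0 X \<epsilon>)
    (limit_space (ext_completion X \<epsilon>) (completion_externology X \<epsilon>)) (in0 X \<epsilon>)"
proof -
  let ?L = "limit_space (ext_completion X \<epsilon>) (completion_externology X \<epsilon>)"
  define ends where "ends = limit_pi0_set X \<epsilon>"
  define g where "g = the_inv_into ends (in0 X \<epsilon>)"
  have "inj_on (in0 X \<epsilon>) ends"
    by (auto simp: inj_on_def ends_def in0_eq_in0_iff)
  then have g: "g (in0 X \<epsilon> a) = a" if "a \<in> ends" for a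
    using that by (simp add: g_def the_inv_into_f_f)
  have topL: "topspace ?L = in0 X \<epsilon> ` ends"
    by (auto simp: limit_space_def limit_set_completion[OF X] topspace_completion[OF X]
        completion_set_eq ends_def)
  have "continuous_map (limit_pi0 X \<epsilon>) (ext_completion X \<epsilon>) (in0 X \<epsilon>)"
    unfolding continuous_map_def openin_completion[OF X] topspace_completion[OF X]
    by (auto simp: completion_set_eq completion_open_def in0_preimage_def)
  then have cont_in0: "continuous_map (limit_pi0 X \<epsilon>) ?L (in0 X \<epsilon>)"
    by (auto simp: limit_space_def continuous_map_in_subtopology limit_set_completion[OF X])
  have coordinate: "continuous_map ?L (pi0 (subtopology X E)) (\<lambda>z. g z E)" if E: "E \<in> \<epsilon>" for E
    unfolding continuous_map_def
  proof (intro conjI allI impI)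
    show "(\<lambda>z. g z E) \<in> topspace ?L \<rightarrow> topspace (pi0 (subtopology X E))"
      using E by (auto simp: topL g ends_def dest: limit_pi0_setD(1))
    fix G assume "openin (pi0 (subtopology X E)) G"
    then have "openin (ext_completion X \<epsilon>) (cylinder X \<epsilon> E G)"
      by (rule openin_cylinder[OF X E])
    moreover have "{z \<in> topspace ?L. g z E \<in> G} = cylinder X \<epsilon> E G \<inter> in0 X \<epsilon> ` ends"
      by (auto simp: topL g in0_in_cylinder_iff[OF X E] ends_def)
    ultimately show "openin ?L {z \<in> topspace ?L. g z E \<in> G}"
      by (auto simp: limit_space_def limit_set_completion[OF X] ends_def openin_subtopology)
  qed
  have "continuous_map ?L (limit_pi0 X \<epsilon>) g"
    unfolding limit_pi0_def continuous_map_in_subtopology continuous_map_componentwise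
    using coordinate by (auto simp: topL g ends_def limit_pi0_set_def PiE_iff)
  with cont_in0 have "homeomorphic_maps (limit_pi0 X \<epsilon>) ?L (in0 X \<epsilon>) g"
    using g by (auto simp: homeomorphic_maps_def topL ends_def)
  then show ?thesis
    by (rule homeomorphic_maps_imp_map)
qed

text \<open>
  The preimage of the point \<open>C\<close> of \<open>\<pi>\<^sub>0(Y)\<close> is the path-component \<open>C\<close> itself, which is open by local
  path-connectedness.
\<close>

lemma openin_pi0_singleton:
  assumes "locally_path_connected_space Y" "C \<in> path_components_of Y"
  shows "openin (pi0 Y) {C}"
proof -
  have "{y \<in> topspace Y. q0 Y y = C} = C"
  proof -
    obtain x where x: "x \<in> topspace Y" "C = q0 Y x"
      using assms(2) by (auto simp: path_components_of_def)
    have "q0 Y y = C \<longleftrightarrow> y \<in> C" if "y \<in> topspace Y" for y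
      using x(1) that path_component_of_equiv[of Y x y] unfolding x(2)
      by (auto simp: set_eq_iff fun_eq_iff)
    moreover have "C \<subseteq> topspace Y"
      using assms(2) by (rule path_components_of_subset)
    ultimately show ?thesis
      by blast
  qed
  then show ?thesis
    using assms openin_path_components_of_locally_path_connected_space[OF assms]
    by (auto simp: pi0_def openin_quotient_topology path_components_of_def)
qed

text \<open>The cylinders over two different points of a discrete \<open>\<pi>\<^sub>0(E)\<close> are open and disjoint.\<close>

lemma separate_ends:
  assumes X: "exterior_space X \<epsilon>" and lpc: "locally_path_connected_space X"
    and a: "a \<in> limit_pi0_set X \<epsilon>" and b: "b \<in> limit_pi0_set X \<epsilon>" and "a \<noteq> b"
  shows "\<exists>W W'. openin (ext_completion X \<epsilon>) W \<and> openin (ext_completion X \<epsilon>) W' \<and>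
    in0 X \<epsilon> a \<in> W \<and> in0 X \<epsilon> b \<in> W' \<and> W \<inter> W' = {}"
proof -
  have "a \<in> (\<Pi>\<^sub>E E\<in>\<epsilon>. path_components_of (subtopology X E))"
    "b \<in> (\<Pi>\<^sub>E E\<in>\<epsilon>. path_components_of (subtopology X E))"
    using a b by (simp_all add: limit_pi0_set_def)
  from PiE_ext[OF this] obtain E where E: "E \<in> \<epsilon>" "a E \<noteq> b E"
    using \<open>a \<noteq> b\<close> by metis
  have "locally_path_connected_space (subtopology X E)"
    using lpc exterior_openin[OF X E(1)] by (rule locally_path_connected_space_open_subset)
  then have "openin (pi0 (subtopology X E)) {c E}" if "c \<in> limit_pi0_set X \<epsilon>" for c
    using limit_pi0_setD(1)[OF that E(1)] by (rule openin_pi0_singleton)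
  then have "openin (ext_completion X \<epsilon>) (cylinder X \<epsilon> E {a E})"
    "openin (ext_completion X \<epsilon>) (cylinder X \<epsilon> E {b E})"
    using a b by (auto intro: openin_cylinder[OF X E(1)])
  moreover have "cylinder X \<epsilon> E {a E} \<inter> cylinder X \<epsilon> E {b E} = {}"
    using E by (intro disjoint_glue compatible_cylinder X) (auto simp: points_over_def ends_over_def)
  ultimately show ?thesis
    using in0_in_cylinder_iff[OF X E(1)] a b by blast
qed

section \<open>Separation in the whole completion\<close>

text \<open>
  A neighbourhood of \<open>x\<close> inside \<open>F\<close> misses the exterior set \<open>X - F\<close>, and every end has a coordinate
  in \<open>\<pi>\<^sub>0(X - F)\<close>.
\<close>

lemma separate_point_from_ends:
  assumes X: "exterior_space X \<epsilon>" and "openin X U" "x \<in> U" "U \<subseteq> F" "topspace X - F \<in> \<epsilon>"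
  shows "\<exists>W W'. openin (ext_completion X \<epsilon>) W \<and> openin (ext_completion X \<epsilon>) W' \<and>
    p0 X \<epsilon> x \<in> W \<and> in0 X \<epsilon> ` limit_pi0_set X \<epsilon> \<subseteq> W' \<and> W \<inter> W' = {}"
proof -
  define E where "E = topspace X - F"
  define G where "G = topspace (pi0 (subtopology X E))"
  have E: "E \<in> \<epsilon>" "U \<inter> E = {}"
    using assms by (auto simp: E_def)
  then have U: "U \<inter> limit_set \<epsilon> = {}"
    using limit_set_subset[OF E(1)] by blast
  have "glue X \<epsilon> U {} \<inter> cylinder X \<epsilon> E G = {}"
    using E U openin_subset[OF assms(2)]
    by (intro disjoint_glue compatible_cylinder X)
      (auto simp: points_over_def compatible_empty_iff)
  moreover have "openin (ext_completion X \<epsilon>) (glue X \<epsilon> U {})"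
    by (rule openin_glue_empty[OF X assms(2) U])
  moreover have "openin (ext_completion X \<epsilon>) (cylinder X \<epsilon> E G)"
    unfolding G_def by (intro openin_cylinder X E openin_topspace)
  moreover have "in0 X \<epsilon> ` limit_pi0_set X \<epsilon> \<subseteq> cylinder X \<epsilon> E G"
    by (auto simp: in0_in_cylinder_iff[OF X E(1)] G_def limit_pi0_setD(1)[OF _ E(1)])
  moreover have "p0 X \<epsilon> x \<in> glue X \<epsilon> U {}"
    using assms(3) by (simp add: glue_def)
  ultimately show ?thesis
    by blast
qed

lemma closedin_limit_set:
  assumes X: "exterior_space X \<epsilon>"
    and nbhd: "\<And>x. x \<in> topspace X - limit_set \<epsilon> \<Longrightarrow>
      \<exists>F. (\<exists>U. openin X U \<and> x \<in> U \<and> U \<subseteq> F) \<and> topspace X - F \<in> \<epsilon>"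
  shows "closedin X (limit_set \<epsilon>)"
  unfolding closedin_def
proof (intro conjI limit_set_subset_topspace[OF X])
  show "openin X (topspace X - limit_set \<epsilon>)"
  proof (subst openin_subopen, intro ballI)
    fix x assume "x \<in> topspace X - limit_set \<epsilon>"
    then obtain F U where U: "openin X U" "x \<in> U" "U \<subseteq> F" "topspace X - F \<in> \<epsilon>"
      using nbhd by blast
    then have "U \<subseteq> topspace X - limit_set \<epsilon>"
      using openin_subset[OF U(1)] limit_set_subset[OF U(4)] by blast
    with U show "\<exists>T. openin X T \<and> x \<in> T \<and> T \<subseteq> topspace X - limit_set \<epsilon>"
      by blast
  qed
qed

lemma separate_points:
  assumes X: "exterior_space X \<epsilon>" and "Hausdorff_space X" and "closedin X (limit_set \<epsilon>)"
    and xy: "x \<in> topspace X - limit_set \<epsilon>" "y \<in> topspace X - limit_set \<epsilon>" "x \<noteq> y"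
  shows "\<exists>W W'. openin (ext_completion X \<epsilon>) W \<and> openin (ext_completion X \<epsilon>) W' \<and>
    p0 X \<epsilon> x \<in> W \<and> p0 X \<epsilon> y \<in> W' \<and> W \<inter> W' = {}"
proof -
  let ?V = "topspace X - limit_set \<epsilon>"
  have V: "openin X ?V"
    using assms(3) by (simp add: closedin_def)
  obtain U U' where U: "openin X U" "openin X U'" "x \<in> U" "y \<in> U'" "U \<inter> U' = {}"
    using assms(2) xy unfolding Hausdorff_space_def disjnt_def by (metis DiffD1)
  have "glue X \<epsilon> (U \<inter> ?V) {} \<inter> glue X \<epsilon> (U' \<inter> ?V) {} = {}"
    using U by (intro disjoint_glue) (auto simp: compatible_empty_iff)
  moreover have "openin (ext_completion X \<epsilon>) (glue X \<epsilon> (U \<inter> ?V) {})"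
    "openin (ext_completion X \<epsilon>) (glue X \<epsilon> (U' \<inter> ?V) {})"
    using U V by (auto intro!: openin_glue_empty X openin_Int)
  moreover have "p0 X \<epsilon> x \<in> glue X \<epsilon> (U \<inter> ?V) {}" "p0 X \<epsilon> y \<in> glue X \<epsilon> (U' \<inter> ?V) {}"
    using U xy by (auto simp: glue_def)
  ultimately show ?thesis
    by blast
qed

lemma Hausdorff_completion:
  assumes X: "exterior_space X \<epsilon>" and lpc: "locally_path_connected_space X"
    and H: "Hausdorff_space X"
    and nbhd: "\<And>x. x \<in> topspace X - limit_set \<epsilon> \<Longrightarrow>
      \<exists>F. (\<exists>U. openin X U \<and> x \<in> U \<and> U \<subseteq> F) \<and> topspace X - F \<in> \<epsilon>"
  shows "Hausdorff_space (ext_completion X \<epsilon>)"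
proof -
  let ?sep = "\<lambda>z z'. \<exists>W W'. openin (ext_completion X \<epsilon>) W \<and> openin (ext_completion X \<epsilon>) W' \<and>
    z \<in> W \<and> z' \<in> W' \<and> W \<inter> W' = {}"
  have sep_sym: "?sep z' z" if "?sep z z'" for z z'
    using that by (metis Int_commute)
  have point_end: "?sep (p0 X \<epsilon> x) (in0 X \<epsilon> a)"
    if x: "x \<in> topspace X - limit_set \<epsilon>" and a: "a \<in> limit_pi0_set X \<epsilon>" for x a
  proof -
    obtain F U where U: "openin X U" "x \<in> U" "U \<subseteq> F" "topspace X - F \<in> \<epsilon>"
      using nbhd[OF x] by blast
    from separate_point_from_ends[OF X this] a show ?thesis
      by blast
  qed
  have cases: "(\<exists>x \<in> topspace X - limit_set \<epsilon>. z = p0 X \<epsilon> x) \<or>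
      (\<exists>a \<in> limit_pi0_set X \<epsilon>. z = in0 X \<epsilon> a)"
    if "z \<in> completion_set X \<epsilon>" for z
    using that e0_in_limit_pi0_set[OF X] p0_eq_in0_iff[of _ X _ \<epsilon>]
    unfolding completion_set_eq by blast
  have "?sep z z'" if "z \<in> completion_set X \<epsilon>" "z' \<in> completion_set X \<epsilon>" "z \<noteq> z'" for z z'
    using cases[OF that(1)]
  proof (elim disjE bexE)
    fix x assume x: "x \<in> topspace X - limit_set \<epsilon>" "z = p0 X \<epsilon> x"
    from cases[OF that(2)] show ?thesis
    proof (elim disjE bexE)
      fix y assume y: "y \<in> topspace X - limit_set \<epsilon>" "z' = p0 X \<epsilon> y"
      have "x \<noteq> y"
        using x(2) y(2) that(3) by blast
      from separate_points[OF X H closedin_limit_set[OF X nbhd] x(1) y(1) this]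
      show ?thesis
        unfolding x(2) y(2) .
    next
      fix a assume a: "a \<in> limit_pi0_set X \<epsilon>" "z' = in0 X \<epsilon> a"
      from point_end[OF x(1) a(1)] show ?thesis
        unfolding x(2) a(2) .
    qed
  next
    fix a assume a: "a \<in> limit_pi0_set X \<epsilon>" "z = in0 X \<epsilon> a"
    from cases[OF that(2)] show ?thesis
    proof (elim disjE bexE)
      fix y assume y: "y \<in> topspace X - limit_set \<epsilon>" "z' = p0 X \<epsilon> y"
      from sep_sym[OF point_end[OF y(1) a(1)]] show ?thesis
        unfolding y(2) a(2) .
    next
      fix b assume b: "b \<in> limit_pi0_set X \<epsilon>" "z' = in0 X \<epsilon> b"
      have "a \<noteq> b"
        using a(2) b(2) that(3) by blast
      from separate_ends[OF X lpc a(1) b(1) this] show ?thesis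
        unfolding a(2) b(2) .
    qed
  qed
  then show ?thesis
    unfolding Hausdorff_space_def topspace_completion[OF X] disjnt_def by blast
qed

theorem theorem3p6:
  fixes X :: "'a topology" and \<epsilon> :: "'a set set"
  assumes "exterior_space X \<epsilon>"
    and "locally_path_connected_space X"
  shows
    "((\<forall>x \<in> limit_set (completion_externology X \<epsilon>).
       \<forall>x' \<in> limit_set (completion_externology X \<epsilon>). x \<noteq> x' \<longrightarrow>
         (\<exists>W W'. openin (ext_completion X \<epsilon>) W \<and> openin (ext_completion X \<epsilon>) W' \<and>
                 x \<in> W \<and> x' \<in> W' \<and> W \<inter> W' = {})) \<and>
      homeomorphic_map (limit_pi0 X \<epsilon>)
        (limit_space (ext_completion X \<epsilon>) (completion_externology X \<epsilon>)) (in0 X \<epsilon>) \<and>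
      Hausdorff_space (limit_pi0 X \<epsilon>) \<and>
      Hausdorff_space (limit_space (ext_completion X \<epsilon>) (completion_externology X \<epsilon>)))
     \<and>
     (Hausdorff_space X \<and>
      (\<forall>x \<in> topspace X - limit_set \<epsilon>.
         \<exists>F. closedin X F \<and> (\<exists>U. openin X U \<and> x \<in> U \<and> U \<subseteq> F) \<and> topspace X - F \<in> \<epsilon>)
      \<longrightarrow> Hausdorff_space (ext_completion X \<epsilon>) \<and> closedin X (limit_set \<epsilon>))"
proof -
  let ?C = "ext_completion X \<epsilon>"
  let ?L = "limit_set (completion_externology X \<epsilon>)"
  let ?LC = "limit_space ?C (completion_externology X \<epsilon>)"
  have separated: "\<forall>x\<in>?L. \<forall>x'\<in>?L. x \<noteq> x' \<longrightarrow>
      (\<exists>W W'. openin ?C W \<and> openin ?C W' \<and> x \<in> W \<and> x' \<in> W' \<and> W \<inter> W' = {})"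
  proof (intro ballI impI)
    fix x x' assume "x \<in> ?L" "x' \<in> ?L" "x \<noteq> x'"
    then obtain a b where ab: "a \<in> limit_pi0_set X \<epsilon>" "b \<in> limit_pi0_set X \<epsilon>"
      "x = in0 X \<epsilon> a" "x' = in0 X \<epsilon> b"
      by (auto simp: limit_set_completion[OF assms(1)])
    then have "a \<noteq> b"
      using \<open>x \<noteq> x'\<close> by blast
    from separate_ends[OF assms ab(1,2) this]
    show "\<exists>W W'. openin ?C W \<and> openin ?C W' \<and> x \<in> W \<and> x' \<in> W' \<and> W \<inter> W' = {}"
      unfolding ab(3,4) .
  qed
  have "Hausdorff_space ?LC"
    unfolding Hausdorff_space_def disjnt_def
  proof (intro allI impI)
    fix x y assume xy: "x \<in> topspace ?LC \<and> y \<in> topspace ?LC \<and> x \<noteq> y"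
    then have "x \<in> ?L" "y \<in> ?L" "x \<noteq> y"
      by (auto simp: limit_space_def)
    with separated obtain W W' where W: "openin ?C W" "openin ?C W'" "x \<in> W" "y \<in> W'" "W \<inter> W' = {}"
      by meson
    show "\<exists>U V. openin ?LC U \<and> openin ?LC V \<and> x \<in> U \<and> y \<in> V \<and> U \<inter> V = {}"
    proof (intro exI conjI)
      show "openin ?LC (W \<inter> ?L)" "openin ?LC (W' \<inter> ?L)"
        using W by (auto simp: limit_space_def intro: openin_subtopology_Int)
    qed (use W \<open>x \<in> ?L\<close> \<open>y \<in> ?L\<close> in auto)
  qed
  moreover have "Hausdorff_space (limit_pi0 X \<epsilon>)"
    using calculation homeomorphic_map_in0[OF assms(1)] homeomorphic_Hausdorff_space
      homeomorphic_map_imp_homeomorphic_space by blast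
  moreover have "Hausdorff_space ?C \<and> closedin X (limit_set \<epsilon>)"
    if "Hausdorff_space X" and nbhds: "\<forall>x \<in> topspace X - limit_set \<epsilon>.
      \<exists>F. closedin X F \<and> (\<exists>U. openin X U \<and> x \<in> U \<and> U \<subseteq> F) \<and> topspace X - F \<in> \<epsilon>"
  proof -
    have nbhd: "\<exists>F. (\<exists>U. openin X U \<and> x \<in> U \<and> U \<subseteq> F) \<and> topspace X - F \<in> \<epsilon>"
      if "x \<in> topspace X - limit_set \<epsilon>" for x
      using that(1) nbhds by blast
    show ?thesis
      using Hausdorff_completion[OF assms \<open>Hausdorff_space X\<close> nbhd]
        closedin_limit_set[OF assms(1) nbhd] by blast
  qed
  ultimately show ?thesis
    using separated homeomorphic_map_in0[OF assms(1)] by blast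
qed

end
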